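(* Let $G_n=T_n\langle t_1,t_2,\ldots,t_k\rangle$ be a Toeplitz graph with $n$ vertices, where $1\le t_1<t_2<\cdots<t_k\le n-1$ are integers, and let $A_n=\{t_1,t_2,\ldots,t_k\}$. Further, let $B_n=\{b_1,b_2,\ldots,b_t\}$ be a minimal, possibly empty, subset of $[n]$ such that $A_n\cap B_n=\emptyset$ and the elements of $A_n\cup B_n$ (in increasing order) form a well-based sequence. Finally, let $$c(x)=1+\sum_{i=1}^{k}x^{t_i}+\sum_{j=1}^{t}x^{b_j}.$$ Then $$i(G_n)\ \ge\ [x^n]\,\frac{c(x)}{(1-x)c(x)-x},$$ where the equality holds if and only if $B_n=\emptyset$, that is, the elements of $A_n$ form a well-based sequence.
   Context: Notation: $[n]=\{1,\ldots,n\}$; $[x^n]h(x)$ is the coefficient of $x^n$ in the formal power series $h$. For a finite simple graph $G$, $i(G)$ is the number of independent sets of $G$ (sets of pairwise non-adjacent vertices), including the empty set. Toeplitz graph: $T_n\langle t_1,\ldots,t_k\rangle$ is the simple graph with vertex set $[n]$ in which distinct vertices $i,j$ are adjacent if and only if $|i-j|\in\{t_1,\ldots,t_k\}$. Well-based sequence: let $m\ge 2$ and let $\mathcal{A}=\{A_1,\ldots,A_m\}$ be a set of binary words of the form $A_i=1\underbrace{0\cdots0}_{a_i-1}1$, where $a_i\ge 1$ and $a_i<a_j$ if $i<j$. The set $\mathcal{A}$ is called well-based if, for every $i>1$, replacing any positive number of the $0$'s in $A_i$ by $1$'s yields a word that contains some word $A_j\in\mathcal{A}$ with $j<i$ as a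 factor (a contiguous subword). The sequence $a_1,\ldots,a_m$ associated with a well-based set is called a well-based sequence. In particular a well-based sequence has at least two terms. It is known that any well-based set must contain the word $11$, i.e. $a_1=1$.
   Formalization: The equality criterion excludes two instances where it fails: n=2, A_n={1}, B_n={2} (both sides 3) and n=3, A_n={1}, B_n={3} (both sides 5), where equality holds although B_n is nonempty. The inequality is kept for them. *)

theory Defs
  imports
    "HOL-Computational_Algebra.Formal_Power_Series"
    "HOL-Library.Sublist"
begin

text \<open>A finite simple graph is a pair of a vertex set and a set of two-element edges.\<close>

type_synonym 'a sgraph = "'a set \<times> 'a set set"

definition toeplitz_graph :: "nat \<Rightarrow> nat set \<Rightarrow> nat sgraph" where
  "toeplitz_graph n T =
     ({1..n}, {{i, j} | i j. i \<in> {1..n} \<and> j \<in> {1..n} \<and> i \<noteq> j \<and> nat \<bar>int i - int j\<bar> \<in> T})"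

definition independent_sets :: "'a sgraph \<Rightarrow> 'a set set" where
  "independent_sets G =
     {S. S \<subseteq> fst G \<and> (\<forall>u\<in>S. \<forall>v\<in>S. u \<noteq> v \<longrightarrow> {u, v} \<notin> snd G)}"

definition num_independent_sets :: "'a sgraph \<Rightarrow> nat" where
  "num_independent_sets G = card (independent_sets G)"

text \<open>Binary words are boolean lists, \<open>True\<close> standing for the letter 1.
  The word \<open>base_word a\<close> is \<open>1 0 ... 0 1\<close> with \<open>a - 1\<close> zeros; it is only meant for \<open>a \<ge> 1\<close>.\<close>

definition base_word :: "nat \<Rightarrow> bool list" where
  "base_word a = True # replicate (a - 1) False @ [True]"

text \<open>\<open>fills u w\<close>: the word \<open>w\<close> arises from \<open>u\<close> by replacing a positive number of 0's by 1's.\<close>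

definition fills :: "bool list \<Rightarrow> bool list \<Rightarrow> bool" where
  "fills u w \<longleftrightarrow> list_all2 (\<longrightarrow>) u w \<and> w \<noteq> u"

text \<open>List positions start at 0, so the condition on the terms after the first one
  concerns the positions \<open>i > 0\<close>. The predicate \<^const>\<open>sublist\<close> is the factor
  (contiguous subword) relation.\<close>

definition well_based :: "nat list \<Rightarrow> bool" where
  "well_based as \<longleftrightarrow>
     2 \<le> length as \<and> (\<forall>a\<in>set as. 1 \<le> a) \<and> sorted_wrt (<) as \<and>
     (\<forall>i. 0 < i \<and> i < length as \<longrightarrow>
        (\<forall>w. fills (base_word (as ! i)) w \<longrightarrow> (\<exists>j<i. sublist (base_word (as ! j)) w)))"

definition completes :: "nat \<Rightarrow> nat set \<Rightarrow> nat set \<Rightarrow> bool" where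
  "completes n A B \<longleftrightarrow>
     B \<subseteq> {1..n} \<and> A \<inter> B = {} \<and> well_based (sorted_list_of_set (A \<union> B))"

text \<open>Minimality is with respect to inclusion; in particular this covers every completing
  set of least cardinality.\<close>

definition minimal_completion :: "nat \<Rightarrow> nat set \<Rightarrow> nat set \<Rightarrow> bool" where
  "minimal_completion n A B \<longleftrightarrow>
     completes n A B \<and> (\<forall>B'. B' \<subset> B \<longrightarrow> \<not> completes n A B')"

definition c_fps :: "nat set \<Rightarrow> nat set \<Rightarrow> real fps" where
  "c_fps A B = 1 + (\<Sum>i\<in>A. fps_X ^ i) + (\<Sum>j\<in>B. fps_X ^ j)"

definition bound_fps :: "nat set \<Rightarrow> nat set \<Rightarrow> real fps" where
  "bound_fps A B = c_fps A B / ((1 - fps_X) * c_fps A B - fps_X)"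

text \<open>Two exceptional instances. A minimal \<open>B\<close> can contain \<open>n\<close> only if \<open>A = {1}\<close> and
  \<open>B = {n}\<close> with \<open>n = 2\<close> or \<open>n = 3\<close>, because a well-based sequence has at least two terms.
  Since no two vertices of \<open>{1..n}\<close> are at distance \<open>n\<close>, equality holds there although \<open>B\<close> is
  nonempty (both sides are 3 and 5, respectively). The equality criterion has to leave out
  exactly these two instances.\<close>

end

theory Submission imports Defs begin

text \<open>For a well-based set \<open>C\<close> every \<open>c \<in> C\<close> and \<open>1 \<le> j < c\<close> satisfy \<open>j \<in> C\<close> or \<open>c - j \<in> C\<close>: fill
  the single zero at position \<open>j\<close>. Hence, if \<open>S \<subseteq> {1..n}\<close> is independent, \<open>n + 1\<close> conflicts with
  some element of \<open>S\<close> iff it conflicts with \<open>Max S\<close>. Let \<open>F\<close> and \<open>G\<close> be the generating functions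
  of the independent sets of the Toeplitz graph of \<open>C\<close>, and of those containing the last vertex.
  Then \<open>c(x) G = x F\<close> and \<open>(1 - x) F = 1 + G\<close>, so \<open>F\<close> is the bound for \<open>C = A \<union> B\<close>. Replacing \<open>C\<close>
  by \<open>A\<close> can only add independent sets, and it adds \<open>{1, b + 1}\<close> for every \<open>b \<in> B\<close> with \<open>b < n\<close>.\<close>

section \<open>Independent sets as sets with forbidden differences\<close>

definition gap_free_sets :: "nat set \<Rightarrow> nat \<Rightarrow> nat set set" where
  "gap_free_sets C n = {S. S \<subseteq> {1..n} \<and> (\<forall>u\<in>S. \<forall>v\<in>S. u < v \<longrightarrow> v - u \<notin> C)}"

text \<open>Testing each pair once, from its smaller end, turns the absolute difference of integers
  into a subtraction of naturals that is never truncated.\<close>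

lemma independent_sets_toeplitz_graph:
  "independent_sets (toeplitz_graph n C) = gap_free_sets C n"
proof -
  have edge: "{u, v} \<in> snd (toeplitz_graph n C) \<longleftrightarrow> nat \<bar>int u - int v\<bar> \<in> C"
    if "u \<in> {1..n}" "v \<in> {1..n}" "u \<noteq> v" for u v
    using that unfolding toeplitz_graph_def
    by (auto simp: doubleton_eq_iff abs_minus_commute)
  have diff: "nat \<bar>int u - int v\<bar> = (if u < v then v - u else u - v)" for u v :: nat
    by auto
  have "(\<forall>u\<in>S. \<forall>v\<in>S. u \<noteq> v \<longrightarrow> {u, v} \<notin> snd (toeplitz_graph n C))
      \<longleftrightarrow> (\<forall>u\<in>S. \<forall>v\<in>S. u < v \<longrightarrow> v - u \<notin> C)" (is "?L \<longleftrightarrow> ?R") if S: "S \<subseteq> {1..n}" for S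
  proof -
    have "({u, v} \<in> snd (toeplitz_graph n C)) = ((if u < v then v - u else u - v) \<in> C)"
      if "u \<in> S" "v \<in> S" "u \<noteq> v" for u v
      using edge[of u v] that S unfolding diff by blast
    then have "?L \<longleftrightarrow> (\<forall>u\<in>S. \<forall>v\<in>S. u \<noteq> v \<longrightarrow> (if u < v then v - u else u - v) \<notin> C)"
      by blast
    also have "\<dots> \<longleftrightarrow> ?R"
      by (metis (full_types) less_asym linorder_neqE_nat less_irrefl)
    finally show ?thesis .
  qed
  moreover have "fst (toeplitz_graph n C) = {1..n}"
    by (simp add: toeplitz_graph_def)
  ultimately show ?thesis
    unfolding independent_sets_def gap_free_sets_def by auto
qed

lemma gap_free_sets_antimono: "C \<subseteq> D \<Longrightarrow> gap_free_sets D n \<subseteq> gap_free_sets C n"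
  unfolding gap_free_sets_def by blast

lemma finite_gap_free_sets [simp]: "finite (gap_free_sets C n)"
  by (rule finite_subset[of _ "Pow {1..n}"]) (auto simp: gap_free_sets_def)

section \<open>Words and the splitting property of well-based sequences\<close>

lemma nth_base_word:
  assumes "1 \<le> c" "i \<le> c"
  shows "base_word c ! i \<longleftrightarrow> i = 0 \<or> i = c"
  using assms unfolding base_word_def by (auto simp: nth_Cons' nth_append)

lemma length_base_word: "1 \<le> c \<Longrightarrow> length (base_word c) = Suc c"
  by (simp add: base_word_def)

text \<open>Filling the zero at \<open>j\<close> creates an occurrence of an earlier, hence shorter,
  base word. Such a word begins and ends with 1, and the filled word has 1's only at 0,
  \<open>j\<close> and \<open>c\<close>.\<close>

lemma well_based_split:
  assumes wb: "well_based as" and c: "c \<in> set as" and j: "1 \<le> j" "j < c"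
  shows "j \<in> set as \<or> c - j \<in> set as"
proof -
  have sorted: "sorted_wrt (<) as" and pos: "\<forall>a\<in>set as. 1 \<le> a" and len: "2 \<le> length as"
    and fill: "\<And>i w. 0 < i \<Longrightarrow> i < length as \<Longrightarrow> fills (base_word (as ! i)) w
      \<Longrightarrow> \<exists>k<i. sublist (base_word (as ! k)) w"
    using wb unfolding well_based_def by blast+
  have fills_update: "fills (base_word a) ((base_word a)[p := True])"
    if "1 \<le> p" "p < a" for a p
  proof -
    have "(base_word a)[p := True] ! p \<noteq> base_word a ! p"
      using that by (simp add: nth_base_word length_base_word)
    then have "(base_word a)[p := True] \<noteq> base_word a"
      by metis
    then show ?thesis
      using that unfolding fills_def
      by (simp add: list_all2_conv_all_nth nth_list_update length_base_word)
  qed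
  have nth_update: "(base_word a)[p := True] ! i \<longleftrightarrow> i = 0 \<or> i = a \<or> i = p"
    if "1 \<le> p" "p < a" "i \<le> a" for a p i
    using that by (auto simp: nth_list_update nth_base_word length_base_word)
  have factor: "a = p \<or> a = b - p"
    if "1 \<le> p" "p < b" "1 \<le> a" "a < b" and sub: "sublist (base_word a) ((base_word b)[p := True])"
    for a b p
  proof -
    let ?w = "(base_word b)[p := True]"
    obtain us vs where w: "?w = us @ base_word a @ vs"
      using sub by (auto simp: sublist_def)
    let ?q = "length us"
    have "length ?w = ?q + Suc a + length vs"
      using w \<open>1 \<le> a\<close> by (simp add: length_base_word)
    then have le: "?q + a \<le> b"
      using that by (simp add: length_base_word)
    \<comment> \<open>The ends of the occurrence are two of the positions 0, \<open>p\<close>,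
      \<open>b\<close>; they are distinct as \<open>1 \<le> a\<close>, and \<open>a < b\<close>
      excludes the pair 0, \<open>b\<close>.\<close>
    have "?w ! ?q" "?w ! (?q + a)"
      using \<open>1 \<le> a\<close> unfolding w by (auto simp: nth_append length_base_word nth_base_word)
    then have "?q = 0 \<or> ?q = b \<or> ?q = p" "?q + a = 0 \<or> ?q + a = b \<or> ?q + a = p"
      using nth_update[OF that(1,2)] le by auto
    then show ?thesis
      using that by auto
  qed
  obtain i where i: "i < length as" "as ! i = c"
    using c by (auto simp: in_set_conv_nth)
  have less: "as ! k < as ! l" if "k < l" "l < length as" for k l
    using sorted that by (simp add: sorted_wrt_iff_nth_less)
  show ?thesis
  proof (cases "i = 0")
    case False
    then obtain k where k: "k < i" "sublist (base_word (as ! k)) ((base_word c)[j := True])"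
      using fill[of i "(base_word c)[j := True]"] i fills_update[OF j] by auto
    then have "as ! k \<in> set as" "as ! k < c"
      using i less[of k i] by auto
    then show ?thesis
      using factor[OF j _ _ k(2)] pos by auto
  next
    case True
    \<comment> \<open>The first term must be 1, since the second word filled with 1's alone contains the first.\<close>
    let ?u = "replicate (Suc (as ! 1)) True"
    have a: "as ! 0 = c" "c < as ! 1"
      using True i less[of 0 1] len by auto
    have "list_all2 (\<longrightarrow>) (base_word (as ! 1)) ?u"
      using a by (auto simp: list_all2_conv_all_nth length_base_word simp del: replicate_Suc)
    moreover have "?u ! 1 \<noteq> base_word (as ! 1) ! 1"
      using a j by (simp add: nth_base_word)
    then have "?u \<noteq> base_word (as ! 1)"
      by metis
    ultimately have "fills (base_word (as ! 1)) ?u"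
      unfolding fills_def by blast
    then have "sublist (base_word c) ?u"
      using fill[of 1 ?u] len a by auto
    \<comment> \<open>As \<open>c > 1\<close>, the word \<open>base_word c\<close> has a zero, which
      no factor of an all-ones word can have.\<close>
    then have "set (base_word c) \<subseteq> set ?u"
      by (rule set_mono_sublist)
    moreover have "False \<in> set (base_word c)"
      using j by (simp add: base_word_def)
    ultimately show ?thesis
      by (auto simp del: replicate_Suc)
  qed
qed

text \<open>The condition on a term mentions only earlier terms, so only the length bound can fail.
  This later rules out \<open>B = {n}\<close> when \<open>A\<close> has at least two
  elements.\<close>

lemma well_based_butlast:
  assumes "well_based (as @ [a])" "2 \<le> length as"
  shows "well_based as"
proof -
  have "\<exists>k<i. sublist (base_word (as ! k)) w"
    if i: "0 < i" "i < length as" and w: "fills (base_word (as ! i)) w" for i w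
  proof -
    have "\<exists>k<i. sublist (base_word ((as @ [a]) ! k)) w"
      using assms(1) i w unfolding well_based_def by (simp add: nth_append)
    then show ?thesis
      using i by (metis nth_append order.strict_trans)
  qed
  then show ?thesis
    using assms unfolding well_based_def by (auto simp: sorted_wrt_append)
qed

section \<open>Counting gap-free sets under the splitting property\<close>

locale splitting_set =
  fixes C :: "nat set"
  assumes finite_C [simp]: "finite C"
    and zero_notin: "0 \<notin> C"
    and split: "\<And>c j. c \<in> C \<Longrightarrow> 1 \<le> j \<Longrightarrow> j < c \<Longrightarrow> j \<in> C \<or> c - j \<in> C"
begin

definition ending_sets :: "nat \<Rightarrow> nat set set" where
  "ending_sets n = {S \<in> gap_free_sets C n. n \<in> S}"

lemma finite_ending_sets [simp]: "finite (ending_sets n)"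
  by (simp add: ending_sets_def)

text \<open>This default value lets the terms \<open>ending_sets (Suc n - c)\<close> with
  \<open>c > n\<close> vanish, since truncation makes their index 0.\<close>

lemma ending_sets_0 [simp]: "ending_sets 0 = {}"
  by (auto simp: ending_sets_def gap_free_sets_def)

lemma Max_ending_sets: "S \<in> ending_sets n \<Longrightarrow> Max S = n"
  unfolding ending_sets_def gap_free_sets_def
  by (auto intro!: Max_eqI dest: finite_subset)

lemma card_gap_free_sets_Suc:
  "card (gap_free_sets C (Suc n)) = card (gap_free_sets C n) + card (ending_sets (Suc n))"
proof -
  have "gap_free_sets C (Suc n) = gap_free_sets C n \<union> ending_sets (Suc n)"
    unfolding ending_sets_def gap_free_sets_def by (auto simp: le_Suc_eq)
  moreover have "gap_free_sets C n \<inter> ending_sets (Suc n) = {}"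
    unfolding ending_sets_def gap_free_sets_def by auto
  ultimately show ?thesis
    by (simp add: card_Un_disjoint)
qed

lemma conflicting_sets:
  "{S \<in> gap_free_sets C n. \<exists>u\<in>S. Suc n - u \<in> C} = (\<Union>c\<in>C. ending_sets (Suc n - c))"
proof (intro equalityI subsetI)
  fix S assume "S \<in> {S \<in> gap_free_sets C n. \<exists>u\<in>S. Suc n - u \<in> C}"
  then obtain v where S: "S \<subseteq> {1..n}" and indep: "\<And>x y. x \<in> S \<Longrightarrow> y \<in> S \<Longrightarrow> x < y \<Longrightarrow> y - x \<notin> C"
    and v: "v \<in> S" "Suc n - v \<in> C"
    by (auto simp: gap_free_sets_def)
  define u where "u = Max S"
  have fin: "finite S"
    using S finite_subset by auto
  then have u: "u \<in> S" "v \<le> u" "u \<le> n"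
    using v S unfolding u_def by (auto intro: Max_in)
  have "Suc n - u \<in> C"
  proof (cases "v = u")
    case False
    \<comment> \<open>Split \<open>Suc n - v\<close> into \<open>u - v\<close> and
      \<open>Suc n - u\<close>; independence of \<open>S\<close> forbids the first part, so the
      second lies in \<open>C\<close>.\<close>
    then have "u - v \<in> C \<or> (Suc n - v) - (u - v) \<in> C"
      using u v by (intro split) auto
    then show ?thesis
      using indep[OF v(1) u(1)] u False by (auto simp: le_neq_implies_less)
  qed (use v in simp)
  moreover have "S \<subseteq> {1..u}"
    using S fin by (auto simp: u_def)
  then have "S \<in> ending_sets u"
    using u indep unfolding ending_sets_def gap_free_sets_def by auto
  ultimately show "S \<in> (\<Union>c\<in>C. ending_sets (Suc n - c))"
    using u by (intro UN_I[of "Suc n - u"]) auto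
next
  fix S assume "S \<in> (\<Union>c\<in>C. ending_sets (Suc n - c))"
  then obtain c where c: "c \<in> C" "S \<in> ending_sets (Suc n - c)"
    by blast
  then have "c \<noteq> 0" "c \<le> n"
    using zero_notin by (metis, metis diff_is_0_eq' empty_iff ending_sets_0 not_less_eq_eq)
  then have "{1..Suc n - c} \<subseteq> {1..n}" "Suc n - (Suc n - c) = c"
    by auto
  then show "S \<in> {S \<in> gap_free_sets C n. \<exists>u\<in>S. Suc n - u \<in> C}"
    using c unfolding ending_sets_def gap_free_sets_def by (metis (no_types, lifting) mem_Collect_eq order.trans)
qed

lemma card_conflicting_sets:
  "card (\<Union>c\<in>C. ending_sets (Suc n - c)) = (\<Sum>c\<in>C. card (ending_sets (Suc n - c)))"
proof (rule card_UN_disjoint)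
  show "\<forall>c\<in>C. \<forall>d\<in>C. c \<noteq> d \<longrightarrow> ending_sets (Suc n - c) \<inter> ending_sets (Suc n - d) = {}"
  proof (intro ballI impI)
    fix c d :: nat assume "c \<noteq> d"
    show "ending_sets (Suc n - c) \<inter> ending_sets (Suc n - d) = {}"
    proof (rule ccontr)
      assume "ending_sets (Suc n - c) \<inter> ending_sets (Suc n - d) \<noteq> {}"
      then obtain S where S: "S \<in> ending_sets (Suc n - c)" "S \<in> ending_sets (Suc n - d)"
        by blast
      then have "Suc n - c = Suc n - d"
        using Max_ending_sets by metis
      \<comment> \<open>Equal indices give \<open>c = d\<close> only if neither subtraction is
        truncated, which a nonzero index guarantees.\<close>
      moreover have "Suc n - c \<noteq> 0"
        using S(1) by (metis empty_iff ending_sets_0)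
      ultimately show False
        using \<open>c \<noteq> d\<close> by linarith
    qed
  qed
qed auto

text \<open>Deleting \<open>Suc n\<close> maps the sets ending there bijectively to the sets on
  \<open>n\<close> vertices without conflict with \<open>Suc n\<close>; the sum counts the
  conflicting ones by their maximum.\<close>

lemma card_ending_sets_Suc:
  "card (ending_sets (Suc n)) + (\<Sum>c\<in>C. card (ending_sets (Suc n - c))) = card (gap_free_sets C n)"
proof -
  let ?good = "{S \<in> gap_free_sets C n. \<forall>u\<in>S. Suc n - u \<notin> C}"
  let ?bad = "{S \<in> gap_free_sets C n. \<exists>u\<in>S. Suc n - u \<in> C}"
  have "bij_betw (insert (Suc n)) ?good (ending_sets (Suc n))"
  proof (rule bij_betw_byWitness[where f' = "\<lambda>S. S - {Suc n}"])
    show "\<forall>S\<in>?good. insert (Suc n) S - {Suc n} = S"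
      by (auto simp: gap_free_sets_def)
    show "\<forall>S\<in>ending_sets (Suc n). insert (Suc n) (S - {Suc n}) = S"
      by (auto simp: ending_sets_def)
    show "insert (Suc n) ` ?good \<subseteq> ending_sets (Suc n)"
      by (force simp: gap_free_sets_def ending_sets_def)
    show "(\<lambda>S. S - {Suc n}) ` ending_sets (Suc n) \<subseteq> ?good"
    proof
      fix T assume "T \<in> (\<lambda>S. S - {Suc n}) ` ending_sets (Suc n)"
      then obtain S where S: "S \<subseteq> {1..Suc n}" "Suc n \<in> S"
          "\<forall>u\<in>S. \<forall>v\<in>S. u < v \<longrightarrow> v - u \<notin> C" and T: "T = S - {Suc n}"
        unfolding ending_sets_def gap_free_sets_def by blast
      have "T \<subseteq> {1..n}"
        using S(1) unfolding T by fastforce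
      then have "u < Suc n" if "u \<in> T" for u
        using that by auto
      with \<open>T \<subseteq> {1..n}\<close> show "T \<in> ?good"
        using S(2,3) T unfolding gap_free_sets_def by blast
    qed
  qed
  then have "card ?good = card (ending_sets (Suc n))"
    by (rule bij_betw_same_card)
  moreover have "card ?bad = (\<Sum>c\<in>C. card (ending_sets (Suc n - c)))"
    using conflicting_sets card_conflicting_sets by metis
  moreover have "gap_free_sets C n = ?good \<union> ?bad" "?good \<inter> ?bad = {}"
    by auto
  then have "card (gap_free_sets C n) = card ?good + card ?bad"
    by (metis (lifting) card_Un_disjoint finite_Un finite_gap_free_sets)
  ultimately show ?thesis
    by simp
qed

lemma gap_free_fps:
  fixes K F :: "real fps"
  defines "K \<equiv> 1 + (\<Sum>c\<in>C. fps_X ^ c)"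
    and "F \<equiv> Abs_fps (\<lambda>n. real (card (gap_free_sets C n)))"
  shows "F = K / ((1 - fps_X) * K - fps_X)"
proof -
  define G :: "real fps" where "G = Abs_fps (\<lambda>n. real (card (ending_sets n)))"
  \<comment> \<open>For \<open>c > n\<close> both sides are 0: the shift leaves no coefficient, and
    \<open>ending_sets 0\<close> is empty.\<close>
  have nth_G: "fps_nth (G * fps_X ^ c) n = real (card (ending_sets (n - c)))" for c n
    by (cases "n < c") (simp_all add: G_def fps_X_power_mult_right_nth)
  have "K * G = fps_X * F"
  proof (rule fps_ext)
    fix n
    have "fps_nth (K * G) n = fps_nth G n + (\<Sum>c\<in>C. fps_nth (G * fps_X ^ c) n)"
      by (simp add: K_def distrib_left mult.commute[of _ G] sum_distrib_left fps_sum_nth)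
    also have "\<dots> = real (card (ending_sets n) + (\<Sum>c\<in>C. card (ending_sets (n - c))))"
      by (simp only: nth_G) (simp add: G_def)
    also have "\<dots> = fps_nth (fps_X * F) n"
      using card_ending_sets_Suc by (cases n) (simp_all add: F_def del: of_nat_add)
    finally show "fps_nth (K * G) n = fps_nth (fps_X * F) n" .
  qed
  moreover have "(1 - fps_X) * F = 1 + G"
  proof (rule fps_ext)
    fix n
    have "gap_free_sets C 0 = {{}}"
      by (auto simp: gap_free_sets_def)
    then show "fps_nth ((1 - fps_X) * F) n = fps_nth (1 + G) n"
      by (cases n) (simp_all add: F_def G_def left_diff_distrib card_gap_free_sets_Suc)
  qed
  \<comment> \<open>Multiply the second relation by \<open>K\<close> and substitute the first to
    eliminate \<open>G\<close>.\<close>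
  ultimately have "K * ((1 - fps_X) * F) - fps_X * F = K"
    by (simp add: distrib_left)
  then have "F * ((1 - fps_X) * K - fps_X) = K"
    by (simp add: algebra_simps)
  \<comment> \<open>Because \<open>0 \<notin> C\<close>, the constant term of \<open>K\<close> is 1;
    hence the denominator is nonzero and can be cancelled.\<close>
  moreover have "fps_nth ((1 - fps_X) * K - fps_X) 0 = 1"
    using zero_notin by (simp add: K_def fps_sum_nth)
  then have "(1 - fps_X) * K - fps_X \<noteq> 0"
    by (metis fps_zero_nth zero_neq_one)
  ultimately show ?thesis
    by (metis nonzero_mult_div_cancel_right)
qed

end

section \<open>Completions, the bound and the equality case\<close>

lemma completes_splitting_set:
  assumes "completes n A B" "finite A"
  shows "splitting_set (A \<union> B)"
proof -
  have fin: "finite (A \<union> B)"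
    using assms finite_subset by (auto simp: completes_def)
  have wb: "well_based (sorted_list_of_set (A \<union> B))"
    using assms(1) by (simp add: completes_def)
  show ?thesis
  proof
    show "0 \<notin> A \<union> B"
      using wb fin by (auto simp: well_based_def)
    show "j \<in> A \<union> B \<or> c - j \<in> A \<union> B" if "c \<in> A \<union> B" "1 \<le> j" "j < c" for c j
      using well_based_split[OF wb, of c j] that fin
      by (simp only: set_sorted_list_of_set)
  qed (fact fin)
qed

lemma bound_fps_eq_card:
  assumes "completes n A B" "finite A"
  shows "fps_nth (bound_fps A B) m = real (card (gap_free_sets (A \<union> B) m))"
proof -
  interpret splitting_set "A \<union> B"
    using assms by (rule completes_splitting_set)
  have "A \<inter> B = {}"
    using assms by (simp add: completes_def)
  then have "c_fps A B = 1 + (\<Sum>c\<in>A \<union> B. fps_X ^ c)"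
    using finite_C by (simp add: c_fps_def sum.union_disjoint add.assoc)
  then have "bound_fps A B = Abs_fps (\<lambda>n. real (card (gap_free_sets (A \<union> B) n)))"
    unfolding bound_fps_def by (simp only: gap_free_fps)
  then show ?thesis
    by simp
qed

text \<open>All of \<open>A\<close> lies below \<open>n\<close>, so with two or more elements
  \<open>A\<close> would be well-based after dropping \<open>n\<close>, against minimality. For
  \<open>A = {a}\<close>, splitting \<open>a\<close> at 1 forces \<open>a = 1\<close>, and splitting
  \<open>n\<close> at 2 forces \<open>n < 4\<close>.\<close>

lemma minimal_completion_last:
  assumes "A \<noteq> {}" "A \<subseteq> {1..n - 1}" and min: "minimal_completion n A {n}"
  shows "(n, A) \<in> {(2, {1}), (3, {1})}"
proof -
  have comp: "completes n A {n}"
    using min by (simp add: minimal_completion_def)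
  have fin: "finite A"
    using assms(2) finite_subset by blast
  have lt: "a < n" if "a \<in> A" for a
    using assms(2) that by force
  obtain a where "a \<in> A"
    using assms(1) by blast
  then have "1 \<le> a" "a < n"
    using assms(2) lt by auto
  then have n: "n \<ge> 2"
    by linarith
  interpret splitting_set "A \<union> {n}"
    using comp fin by (rule completes_splitting_set)
  have "sorted_list_of_set (A \<union> {n}) = sorted_list_of_set A @ [n]"
    using fin lt
    by (intro sorted_distinct_set_unique) (auto simp: sorted_append less_imp_le
      simp del: sorted_list_of_set_insert_remove)
  then have "well_based (sorted_list_of_set A @ [n])"
    using comp by (simp add: completes_def)
  moreover have "\<not> completes n A {}"
    using min unfolding minimal_completion_def by blast
  then have "\<not> well_based (sorted_list_of_set A)"
    by (simp add: completes_def)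
  ultimately have "\<not> 2 \<le> card A"
    using well_based_butlast[of "sorted_list_of_set A" n] by (metis length_sorted_list_of_set)
  moreover have "card A \<noteq> 0"
    using fin assms(1) by simp
  ultimately have "card A = 1"
    by linarith
  then obtain a where A: "A = {a}"
    by (auto simp: card_1_singleton_iff)
  have a: "1 \<le> a" "a < n"
    using A assms(2) lt by auto
  have "a = 1"
    using split[of a 1] a A by (cases "a = 1") auto
  moreover have "n < 4"
    using split[of n 2] A \<open>a = 1\<close> by (cases "n < 4") auto
  ultimately show ?thesis
    using n A by auto
qed

theorem theorem2p2:
  fixes n :: nat and A B :: "nat set"
  assumes "A \<noteq> {}" and "A \<subseteq> {1..n - 1}"
    and "minimal_completion n A B"
  shows "real (num_independent_sets (toeplitz_graph n A)) \<ge> fps_nth (bound_fps A B) n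
    \<and> ((n, A, B) \<notin> {(2, {1}, {2}), (3, {1}, {3})} \<longrightarrow>
        (real (num_independent_sets (toeplitz_graph n A)) = fps_nth (bound_fps A B) n
          \<longleftrightarrow> B = {}))
    \<and> (B = {} \<longleftrightarrow> well_based (sorted_list_of_set A))"
proof -
  have comp: "completes n A B"
    using assms(3) by (simp add: minimal_completion_def)
  have fin: "finite A"
    using assms(2) finite_subset by blast
  let ?I = "gap_free_sets A n" and ?J = "gap_free_sets (A \<union> B) n"
  have I: "num_independent_sets (toeplitz_graph n A) = card ?I"
    by (simp add: num_independent_sets_def independent_sets_toeplitz_graph)
  have J: "fps_nth (bound_fps A B) n = real (card ?J)"
    using bound_fps_eq_card[OF comp fin] .
  have sub: "?J \<subseteq> ?I"
    by (rule gap_free_sets_antimono) simp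
  have "B = {}" if exc: "(n, A, B) \<notin> {(2, {1}, {2}), (3, {1}, {3})}" and eq: "card ?I = card ?J"
  proof (rule ccontr)
    assume "B \<noteq> {}"
    have "B \<noteq> {n}"
      using minimal_completion_last[OF assms(1,2)] assms(3) exc by auto
    then obtain b where b: "b \<in> B" "b \<noteq> n"
      using \<open>B \<noteq> {}\<close> by blast
    then have b': "b \<notin> A" "1 \<le> b" "b < n"
      using comp by (auto simp: completes_def)
    \<comment> \<open>The only difference is \<open>b\<close>, which is in \<open>B\<close> but not
      in \<open>A\<close>; \<open>b < n\<close> keeps \<open>Suc b\<close> among the
      vertices.\<close>
    have "{1, Suc b} \<in> ?I" "{1, Suc b} \<notin> ?J"
      using b b' by (auto simp: gap_free_sets_def)
    moreover have "?I = ?J"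
      using card_subset_eq[OF finite_gap_free_sets sub] eq by simp
    ultimately show False
      by blast
  qed
  \<comment> \<open>If \<open>A\<close> is well-based, then \<open>{}\<close> is already a
    completion, and minimality leaves no other.\<close>
  moreover have "B = {}" if "well_based (sorted_list_of_set A)"
  proof (rule ccontr)
    assume "B \<noteq> {}"
    then have "\<not> completes n A {}"
      using assms(3) unfolding minimal_completion_def by blast
    then show False
      using that by (simp add: completes_def)
  qed
  moreover have "well_based (sorted_list_of_set A)" if "B = {}"
    using comp that by (simp add: completes_def)
  moreover have "card ?J \<le> card ?I"
    using sub by (intro card_mono) auto
  moreover have "card ?I = card ?J" if "B = {}"
    using that by simp
  ultimately show ?thesis
    unfolding I J of_nat_le_iff of_nat_eq_iff by blast
qed

end
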